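(* Let $N \geq 1$ be an integer and $\beta \in [0,1)$, with $(N,\beta) \neq (1,0)$. i) If $1 < p < \frac{N}{N-1+\beta}$, then there exists a constant $C = C(p, \beta, N)$ such that $$|\tilde{T}_j^\beta f(x) - \tilde{T}_j^\beta f(z)| \leq C|x-z|^{N+\beta-\frac{N}{p}} \|f\|_{L^p(\mathbb{R}^N)}$$ for all $f \in L^p(\mathbb{R}^N)$, all $j = 1, \ldots, N$ and all $x, z \in \mathbb{R}^N$. ii) If $p = \frac{N}{N-1+\beta}$ and $1 \leq q < p$, then there exists a constant $C = C(q, \beta, N)$ such that $$|\tilde{T}_j^\beta f(x) - \tilde{T}_j^\beta f(z)| \leq C|x-z| \,\bigl(|\ln|x-z||+1\bigr)^{\frac{1}{p'}} \left( \|f\|_{L^p(\mathbb{R}^N)} + \|f\|_{L^q(\mathbb{R}^N)} \right)$$ for all $f \in L^p(\mathbb{R}^N) \cap L^q(\mathbb{R}^N)$, all $j = 1, \ldots, N$ and all $x, z \in \mathbb{R}^N$.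
   Context: Here $p' = \frac{p}{p-1}$, and when $x=z$ the right-hand side of the inequality in ii) is understood as $0$. For $\beta \in [0,1)$ and $j = 1,\dots,N$, $$\tilde{T}_j^\beta f(x) := \frac{\gamma(N, N-1+\beta)}{N-1+\beta} \int_{\mathbb{R}^N} \left[ \frac{y_j - x_j}{|y-x|^{1-\beta}} - \frac{y_j}{|y|^{1-\beta}} \right] f(y) \, dy,$$ where, for $0<\alpha<N$, $\gamma(N,\alpha) := \dfrac{\Gamma(\frac{N-\alpha}{2})}{\pi^{\frac{N}{2}} 2^\alpha \Gamma(\frac{\alpha}{2})}$. *)

theory Defs
  imports "HOL-Analysis.Analysis"
begin

text \<open>
  Elements of \<open>L^p\<close> are represented by real-valued Lebesgue measurable functions, not by
  equivalence classes. Only finite exponents \<open>p \<ge> 1\<close> are intended.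
\<close>

definition Lp_space :: "real \<Rightarrow> ('a::euclidean_space \<Rightarrow> real) set" where
  "Lp_space p = {f. f \<in> borel_measurable lebesgue \<and> integrable lebesgue (\<lambda>x. \<bar>f x\<bar> powr p)}"

definition Lp_norm :: "real \<Rightarrow> ('a::euclidean_space \<Rightarrow> real) \<Rightarrow> real" where
  "Lp_norm p f = (\<integral>x. \<bar>f x\<bar> powr p \<partial>lebesgue) powr (1 / p)"

definition conj_exponent :: "real \<Rightarrow> real" where
  "conj_exponent p = p / (p - 1)"

text \<open>The normalising constant of the Riesz potential of order \<open>\<alpha>\<close>, for \<open>0 < \<alpha> < N\<close>.\<close>

definition riesz_const :: "nat \<Rightarrow> real \<Rightarrow> real" where
  "riesz_const N \<alpha> =
     Gamma ((real N - \<alpha>) / 2) / (pi powr (real N / 2) * 2 powr \<alpha> * Gamma (\<alpha> / 2))"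

definition T_integrand ::
    "real \<Rightarrow> 'n \<Rightarrow> (real ^ 'n::finite \<Rightarrow> real) \<Rightarrow> real ^ 'n \<Rightarrow> real ^ 'n \<Rightarrow> real" where
  "T_integrand \<beta> j f x y =
     ((y $ j - x $ j) / norm (y - x) powr (1 - \<beta>) - y $ j / norm y powr (1 - \<beta>)) * f y"

text \<open>
  The Bochner integral is \<open>0\<close> by convention when the integrand is not integrable, so the value
  is meaningful only together with integrability of \<open>T_integrand \<beta> j f x\<close>.
\<close>

definition T_tilde :: "real \<Rightarrow> 'n \<Rightarrow> (real ^ 'n::finite \<Rightarrow> real) \<Rightarrow> real ^ 'n \<Rightarrow> real" where
  "T_tilde \<beta> j f x =
     riesz_const CARD('n) (real CARD('n) - 1 + \<beta>) / (real CARD('n) - 1 + \<beta>)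
       * (\<integral>y. T_integrand \<beta> j f x y \<partial>lebesgue)"

end

theory Submission
  imports Defs
begin

text \<open>
  The kernel \<open>K(y) = y\<^sub>j / |y| powr (1 - \<beta>)\<close> satisfies
  \<open>|K(y - x) - K(y - z)| \<le> 6 h (h + |y - z|) powr (\<beta> - 1)\<close> with \<open>h = |x - z|\<close>. Hoelder's
  inequality reduces both parts to the \<open>p'\<close>-norm of the weight \<open>(h + |y - z|) powr (\<beta> - 1)\<close>.
  In part i) its \<open>p'\<close>-th power decays faster than \<open>|y| powr (-N)\<close>, and the weight is integrable
  with the right scaling in \<open>h\<close>. In part ii) the \<open>p'\<close>-th power is \<open>(h + |y - z|) powr (-N)\<close>,
  whose integral over the unit ball grows logarithmically in \<open>1 / h\<close>; outside that ball the
  weight is paired with the \<open>L\<^sup>q\<close>-norm of \<open>f\<close>.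
\<close>

section \<open>Pointwise estimate of the kernel\<close>

text \<open>Insert the mixed term \<open>a $ j * norm b powr (\<beta> - 1)\<close>. One resulting
  difference is linear in \<open>a - b\<close>. The other is at most
  \<open>norm a powr \<beta> - norm a * norm b powr (\<beta> - 1)\<close>; the ordering of the norms
  and \<beta> \<ge> 0 allow \<open>norm b powr \<beta>\<close> in place of the first power, which
  leaves \<open>(norm b - norm a) * norm b powr (\<beta> - 1)\<close>.\<close>

lemma component_over_norm_powr_diff_ordered:
  fixes a b :: "real ^ 'n::finite"
  assumes "0 \<le> \<beta>" "\<beta> < 1" "norm a \<le> norm b" "b \<noteq> 0"
  shows "\<bar>a $ j / norm a powr (1 - \<beta>) - b $ j / norm b powr (1 - \<beta>)\<bar>
    \<le> 2 * norm (a - b) * norm b powr (\<beta> - 1)"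
proof -
  define r where "r = norm b powr (\<beta> - 1)"
  have r: "r \<ge> 0" "b $ j / norm b powr (1 - \<beta>) = b $ j * r"
    unfolding r_def by (simp_all add: powr_minus_divide[of _ "1 - \<beta>", simplified])
  have ab: "\<bar>a $ j - b $ j\<bar> \<le> norm (a - b)"
    using component_le_norm_cart[of "a - b" j] by simp
  have second: "\<bar>a $ j / norm a powr (1 - \<beta>) - a $ j * r\<bar> \<le> norm (a - b) * r"
  proof (cases "a = 0")
    case False
    have pos: "0 < norm a" "0 < norm b" using False assms by auto
    have le: "norm a powr (\<beta> - 1) \<ge> r"
      unfolding r_def using assms pos by (intro powr_mono2') auto
    have "norm a * norm a powr (\<beta> - 1) = norm a powr \<beta>"
      using pos by (simp add: powr_mult_base)
    also have "\<dots> \<le> norm b powr \<beta>"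
      using assms by (intro powr_mono2) auto
    also have "\<dots> = norm b * r"
      using pos by (simp add: r_def powr_mult_base)
    finally have *: "norm a * norm a powr (\<beta> - 1) \<le> norm b * r" .
    have "a $ j / norm a powr (1 - \<beta>) = a $ j * norm a powr (\<beta> - 1)"
      by (simp add: powr_minus_divide[of _ "1 - \<beta>", simplified])
    then have "\<bar>a $ j / norm a powr (1 - \<beta>) - a $ j * r\<bar> = \<bar>a $ j\<bar> * (norm a powr (\<beta> - 1) - r)"
      using le by (simp add: abs_mult flip: right_diff_distrib)
    also have "\<dots> \<le> norm a * (norm a powr (\<beta> - 1) - r)"
      using le component_le_norm_cart[of a j] by (intro mult_right_mono) auto
    also have "\<dots> \<le> (norm b - norm a) * r"
      using * by (simp add: algebra_simps)
    also have "\<dots> \<le> norm (a - b) * r"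
      using r norm_triangle_ineq2[of b a] by (intro mult_right_mono) (auto simp: norm_minus_commute)
    finally show ?thesis .
  qed (use r in auto)
  have "\<bar>a $ j * r - b $ j * r\<bar> \<le> norm (a - b) * r"
    using ab r by (simp add: abs_mult mult_right_mono flip: left_diff_distrib)
  with second r show ?thesis
    unfolding r_def[symmetric] by linarith
qed

text \<open>By symmetry the ordered estimate holds with the larger norm \<open>m\<close>. Since
  \<open>norm (a - b) + norm b\<close> is at most \<open>3 * m\<close>, replacing \<open>m\<close>
  costs a factor 3 powr (1 - \<beta>) \<le> 3, whence 6 = 2 * 3. With \<open>a = y - x\<close> and
  \<open>b = y - z\<close> the resulting weight is centred at \<open>z\<close> and has no
  singularity when \<open>x\<close> and \<open>z\<close> differ.\<close>

lemma component_over_norm_powr_diff: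
  fixes a b :: "real ^ 'n::finite"
  assumes "0 \<le> \<beta>" "\<beta> < 1"
  shows "\<bar>a $ j / norm a powr (1 - \<beta>) - b $ j / norm b powr (1 - \<beta>)\<bar>
    \<le> 6 * norm (a - b) * (norm (a - b) + norm b) powr (\<beta> - 1)"
proof (cases "a = b")
  case False
  define m where "m = max (norm a) (norm b)"
  have m: "m > 0" using False by (auto simp: m_def less_max_iff_disj)
  have "\<bar>a $ j / norm a powr (1 - \<beta>) - b $ j / norm b powr (1 - \<beta>)\<bar>
    \<le> 2 * norm (a - b) * m powr (\<beta> - 1)"
  proof (cases "norm a \<le> norm b")
    case True
    then show ?thesis using component_over_norm_powr_diff_ordered[of \<beta> a b j] assms m
      by (auto simp: m_def max_def)
  next
    case False
    then show ?thesis using component_over_norm_powr_diff_ordered[of \<beta> b a j] assms m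
      by (auto simp: m_def max_def norm_minus_commute abs_minus_commute)
  qed
  also have "2 * norm (a - b) * m powr (\<beta> - 1)
      \<le> 2 * norm (a - b) * (3 * (norm (a - b) + norm b) powr (\<beta> - 1))"
  proof (intro mult_left_mono)
    have "norm (a - b) + norm b \<le> 3 * m"
      using norm_triangle_ineq4[of a b] by (auto simp: m_def)
    then have "(3 * m) powr (\<beta> - 1) \<le> (norm (a - b) + norm b) powr (\<beta> - 1)"
      using assms False by (intro powr_mono2') (auto intro: add_pos_nonneg)
    moreover have "m powr (\<beta> - 1) = 3 powr (1 - \<beta>) * (3 * m) powr (\<beta> - 1)"
      using m by (simp add: powr_mult flip: powr_add mult.assoc)
    moreover have "3 powr (1 - \<beta>) \<le> (3::real)"
      using assms powr_mono[of "1 - \<beta>" 1 "3::real"] by simp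
    ultimately show "m powr (\<beta> - 1) \<le> 3 * (norm (a - b) + norm b) powr (\<beta> - 1)"
      using mult_mono[of "3 powr (1 - \<beta>)" 3 "(3 * m) powr (\<beta> - 1)"
          "(norm (a - b) + norm b) powr (\<beta> - 1)"] by simp
  qed simp
  finally show ?thesis by simp
qed simp

section \<open>Integrals of the weight beyond the critical exponent\<close>

lemma nn_integral_shifted_norm_powr:
  fixes z :: "'a::euclidean_space"
  assumes a: "a > 0" and s: "s > real DIM('a)"
  shows "(\<integral>\<^sup>+y. ennreal ((a + norm (y - z)) powr (-s)) \<partial>lborel)
    \<le> ennreal (s * unit_ball_vol (real DIM('a)) / (s - real DIM('a)) * a powr (real DIM('a) - s))"
proof -
  define n where "n = real DIM('a)"
  define v where "v = unit_ball_vol n"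
  have n: "n \<ge> 1" unfolding n_def using DIM_positive[where 'a='a] by linarith
  have v: "v > 0" unfolding v_def using n by simp
  have sn: "s > n" using s by (simp add: n_def)
  define g where "g r = s * (a + r) powr (-s - 1)" for r
  have [measurable]: "g \<in> borel_measurable borel" unfolding g_def by measurable
  \<comment> \<open>Write the integrand as an integral over the radii \<open>r \<ge> |y - z|\<close> and swap the integrals,
    so that only volumes of balls are needed.\<close>
  have FTC: "(\<integral>\<^sup>+r. ennreal (t * (a + r) powr (-t - 1)) * indicator {b..} r \<partial>lborel)
      = ennreal ((a + b) powr (-t))" if t: "t > 0" and "b \<ge> 0" for t b
  proof -
    have "(\<integral>\<^sup>+r. ennreal (t * (a + r) powr (-t - 1)) * indicator {b..} r \<partial>lborel)
      = ennreal (0 - (- ((a + b) powr (-t))))"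
    proof (rule nn_integral_FTC_atLeast[where F="\<lambda>r. - ((a + r) powr (-t))"])
      show "((\<lambda>r. - ((a + r) powr (-t))) has_real_derivative t * (a + x) powr (- t - 1)) (at x)"
        if "b \<le> x" for x
        using that a \<open>b \<ge> 0\<close> by (auto intro!: derivative_eq_intros)
      have "((\<lambda>r. (a + r) powr (-t)) \<longlongrightarrow> 0) at_top"
        using t by (intro tendsto_neg_powr filterlim_tendsto_add_at_top[OF tendsto_const] filterlim_ident) auto
      then show "((\<lambda>r. - ((a + r) powr (-t))) \<longlongrightarrow> 0) at_top"
        using tendsto_minus by fastforce
    qed (use t in auto)
    then show ?thesis by simp
  qed
  have "(\<integral>\<^sup>+y. ennreal ((a + norm (y - z)) powr (-s)) \<partial>lborel)
      = (\<integral>\<^sup>+y. \<integral>\<^sup>+r. ennreal (g r) * indicator {norm (y - z)..} r \<partial>lborel \<partial>lborel)"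
    using FTC[of s] n sn by (simp add: g_def)
  \<comment> \<open>The region is written as a set of pairs so that joint measurability, needed for
    the exchange of integrals, can be derived.\<close>
  also have "\<dots> = (\<integral>\<^sup>+y. \<integral>\<^sup>+r. ennreal (g r) * indicator {p. dist z (fst p) \<le> snd p} (y, r) \<partial>lborel \<partial>lborel)"
    by (intro nn_integral_cong) (auto simp: indicator_def dist_norm norm_minus_commute)
  also have "\<dots> = (\<integral>\<^sup>+r. \<integral>\<^sup>+y. ennreal (g r) * indicator {p. dist z (fst p) \<le> snd p} (y, r) \<partial>lborel \<partial>lborel)"
    by (intro lborel_pair.Fubini') measurable
  also have "\<dots> = (\<integral>\<^sup>+r. ennreal (g r) * emeasure lborel (cball z r) \<partial>lborel)"
  proof (intro nn_integral_cong)
    fix r :: real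
    have "(\<integral>\<^sup>+y. ennreal (g r) * indicator {p. dist z (fst p) \<le> snd p} (y, r) \<partial>lborel)
        = (\<integral>\<^sup>+y. ennreal (g r) * indicator (cball z r) y \<partial>lborel)"
      by (intro nn_integral_cong) (auto simp: indicator_def)
    then show "(\<integral>\<^sup>+y. ennreal (g r) * indicator {p. dist z (fst p) \<le> snd p} (y, r) \<partial>lborel)
        = ennreal (g r) * emeasure lborel (cball z r)"
      by (simp add: nn_integral_cmult_indicator)
  qed
  \<comment> \<open>The ball volume \<open>v * r ^ DIM('a)\<close> is at most
    \<open>v * (a + r) powr n\<close>. The majorant is again a multiple of a derivative, now of a
    power with exponent \<open>-(s - n)\<close>, so \<open>FTC\<close> applies a second time. For
    negative \<open>r\<close> the ball is empty.\<close>
  also have "\<dots> \<le> (\<integral>\<^sup>+r. ennreal (s * v / (s - n)) *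
      (ennreal ((s - n) * (a + r) powr (-(s - n) - 1)) * indicator {0..} r) \<partial>lborel)"
  proof (intro nn_integral_mono)
    fix r :: real
    show "ennreal (g r) * emeasure lborel (cball z r) \<le> ennreal (s * v / (s - n)) *
      (ennreal ((s - n) * (a + r) powr (-(s - n) - 1)) * indicator {0..} r)"
    proof (cases "r \<ge> 0")
      case True
      have "r ^ DIM('a) \<le> (a + r) powr n"
        using True a by (simp add: n_def powr_realpow power_mono)
      then have "g r * (v * r ^ DIM('a)) \<le> g r * (v * (a + r) powr n)"
        using v n sn by (intro mult_left_mono) (auto simp: g_def)
      also have "\<dots> = s * v * (a + r) powr (-(s - n) - 1)"
        using True a by (simp add: g_def algebra_simps flip: powr_add)
      also have "\<dots> = s * v / (s - n) * ((s - n) * (a + r) powr (-(s - n) - 1))"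
        using sn by simp
      finally show ?thesis
        using True v n sn
        by (simp add: emeasure_cball g_def indicator_def flip: n_def v_def ennreal_mult)
    qed simp
  qed
  also have "\<dots> = ennreal (s * v / (s - n)) * ennreal (a powr (-(s - n)))"
    using FTC[of "s - n" 0] sn by (subst nn_integral_cmult) auto
  also have "\<dots> = ennreal (s * v / (s - n) * a powr (n - s))"
    using sn n v by (subst ennreal_mult[symmetric]) auto
  finally show ?thesis by (simp add: v_def n_def)
qed

text \<open>The constant stays explicit because its growth like 1 / (s - DIM), as \<open>s\<close>
  approaches the dimension, is what becomes the logarithm at the critical exponent.\<close>

lemma shifted_norm_powr_lebesgue:
  fixes z :: "'a::euclidean_space"
  assumes a: "a > 0" and s: "s > real DIM('a)"
  shows "integrable lebesgue (\<lambda>y. (a + norm (y - z)) powr (-s))"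
    and "(\<integral>y. (a + norm (y - z)) powr (-s) \<partial>lebesgue)
      \<le> s * unit_ball_vol (real DIM('a)) / (s - real DIM('a)) * a powr (real DIM('a) - s)"
proof -
  let ?f = "\<lambda>y. (a + norm (y - z)) powr (-s)"
  let ?B = "s * unit_ball_vol (real DIM('a)) / (s - real DIM('a)) * a powr (real DIM('a) - s)"
  have le: "(\<integral>\<^sup>+y. ennreal (?f y) \<partial>lebesgue) \<le> ennreal ?B"
    using nn_integral_shifted_norm_powr[OF assms] by (simp add: nn_integral_completion)
  have meas: "?f \<in> borel_measurable lebesgue"
    by (rule measurable_completion) simp
  show int: "integrable lebesgue ?f"
    using le meas by (intro integrableI_bounded) (auto simp: le_less_trans[OF _ ennreal_less_top])
  have "?B \<ge> 0" using s by simp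
  with le show "(\<integral>y. ?f y \<partial>lebesgue) \<le> ?B"
    using int by (simp add: nn_integral_eq_integral)
qed

section \<open>Hoelder's inequality\<close>

text \<open>Young's inequality for the functions themselves gives integrability. For functions
  divided by their norms \<open>A\<close> and \<open>B\<close> it gives the bound, as the two
  integrals add up to 1 / p + 1 / q = 1. If a norm is zero, the product vanishes almost
  everywhere.\<close>

lemma Lp_Holder:
  fixes f g :: "'a::euclidean_space \<Rightarrow> real"
  assumes f: "f \<in> Lp_space p" and g: "g \<in> Lp_space q" and pq: "1 < p" "1 < q" "1 / p + 1 / q = 1"
  shows "integrable lebesgue (\<lambda>x. f x * g x)"
    and "(\<integral>x. \<bar>f x * g x\<bar> \<partial>lebesgue) \<le> Lp_norm p f * Lp_norm q g"
proof -
  have meas [measurable]: "f \<in> borel_measurable lebesgue" "g \<in> borel_measurable lebesgue"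
    and fp: "integrable lebesgue (\<lambda>x. \<bar>f x\<bar> powr p)" and gq: "integrable lebesgue (\<lambda>x. \<bar>g x\<bar> powr q)"
    using f g by (auto simp: Lp_space_def)
  have "integrable lebesgue (\<lambda>x. \<bar>f x\<bar> powr p / p + \<bar>g x\<bar> powr q / q)"
    using fp gq by simp
  then show int: "integrable lebesgue (\<lambda>x. f x * g x)"
  proof (rule Bochner_Integration.integrable_bound)
    show "AE x in lebesgue. norm (f x * g x) \<le> norm (\<bar>f x\<bar> powr p / p + \<bar>g x\<bar> powr q / q)"
      using Youngs_inequality[OF pq] pq by (intro AE_I2) (simp add: abs_mult)
  qed simp
  define A where "A = Lp_norm p f"
  define B where "B = Lp_norm q g"
  have AB: "A \<ge> 0" "B \<ge> 0" by (auto simp: A_def B_def Lp_norm_def)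
  have Ap: "A powr p = (\<integral>x. \<bar>f x\<bar> powr p \<partial>lebesgue)" and Bq: "B powr q = (\<integral>x. \<bar>g x\<bar> powr q \<partial>lebesgue)"
    using pq by (auto simp: A_def B_def Lp_norm_def powr_powr)
  show "(\<integral>x. \<bar>f x * g x\<bar> \<partial>lebesgue) \<le> Lp_norm p f * Lp_norm q g"
  proof (cases "A = 0 \<or> B = 0")
    case True
    have "AE x in lebesgue. f x * g x = 0"
    proof (cases "A = 0")
      case True
      then have "AE x in lebesgue. \<bar>f x\<bar> powr p = 0"
        using Ap fp by (subst (asm) eq_commute, simp add: integral_nonneg_eq_0_iff_AE)
      then show ?thesis by eventually_elim simp
    next
      case False
      with \<open>A = 0 \<or> B = 0\<close> have "AE x in lebesgue. \<bar>g x\<bar> powr q = 0"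
        using Bq gq by (subst (asm) eq_commute, simp add: integral_nonneg_eq_0_iff_AE)
      then show ?thesis by eventually_elim simp
    qed
    then have "AE x in lebesgue. \<bar>f x * g x\<bar> = 0"
      by eventually_elim simp
    then have "(\<integral>x. \<bar>f x * g x\<bar> \<partial>lebesgue) = 0"
      by (rule integral_eq_zero_AE)
    then show ?thesis using AB by (simp flip: A_def B_def)
  next
    case False
    then have pos: "A > 0" "B > 0" using AB by auto
    have "(\<integral>x. \<bar>f x * g x\<bar> \<partial>lebesgue) \<le> (\<integral>x. A * B *
        (\<bar>f x\<bar> powr p / (p * A powr p) + \<bar>g x\<bar> powr q / (q * B powr q)) \<partial>lebesgue)"
    proof (rule integral_mono)
      fix x
      have "\<bar>f x * g x\<bar> = A * B * ((\<bar>f x\<bar> / A) * (\<bar>g x\<bar> / B))"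
        using pos by (simp add: abs_mult)
      also have "\<dots> \<le> A * B * ((\<bar>f x\<bar> / A) powr p / p + (\<bar>g x\<bar> / B) powr q / q)"
        using pos by (intro mult_left_mono Youngs_inequality pq) auto
      finally show "\<bar>f x * g x\<bar> \<le> A * B *
          (\<bar>f x\<bar> powr p / (p * A powr p) + \<bar>g x\<bar> powr q / (q * B powr q))"
        using pos by (simp add: powr_divide mult.commute)
    qed (use int fp gq in auto)
    also have "\<dots> = A * B * (A powr p / (p * A powr p) + B powr q / (q * B powr q))"
      using fp gq by (simp add: Ap Bq)
    also have "\<dots> = A * B"
      using pos pq by simp
    finally show ?thesis by (simp add: A_def B_def)
  qed
qed

section \<open>The weight at the critical exponent\<close>

lemma shifted_norm_powr_measurable [measurable]:
  fixes z :: "'a::euclidean_space"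
  shows "(\<lambda>y. (a + norm (y - z)) powr t) \<in> borel_measurable lebesgue"
  by (rule measurable_completion) simp

lemma shifted_norm_powr_critical:
  fixes z :: "'a::euclidean_space"
  defines "n \<equiv> real DIM('a)"
  assumes a: "a > 0"
  shows "integrable lebesgue (\<lambda>y. indicator (cball z 1) y * (a + norm (y - z)) powr (-n))"
    and "(\<integral>y. indicator (cball z 1) y * (a + norm (y - z)) powr (-n) \<partial>lebesgue)
      \<le> exp 1 * (n + 1) * unit_ball_vol n * (\<bar>ln a\<bar> + 1)"
proof -
  \<comment> \<open>On the ball, \<open>(a + |y - z|) powr (-n)\<close> is at most \<open>(a + 1) powr e\<close> times the integrable
    power with exponent \<open>-(n + e)\<close>; this choice of \<open>e\<close> turns the factor \<open>1 / e\<close> of the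
    convergent integral into the logarithm while \<open>((a + 1) / a) powr e\<close> stays bounded.\<close>
  define e where "e = 1 / (\<bar>ln a\<bar> + 1)"
  have e: "0 < e" "e \<le> 1" by (auto simp: e_def)
  have n: "n \<ge> 0" by (simp add: n_def)
  let ?f = "\<lambda>y. indicator (cball z 1) y * (a + norm (y - z)) powr (-n)"
  let ?g = "\<lambda>y. (a + 1) powr e * (a + norm (y - z)) powr (-(n + e))"
  have le: "?f y \<le> ?g y" for y
  proof (cases "y \<in> cball z 1")
    case True
    then have "norm (y - z) \<le> 1" by (simp add: dist_norm norm_minus_commute)
    then have "(a + norm (y - z)) powr e \<le> (a + 1) powr e"
      using a e by (intro powr_mono2) auto
    then have "(a + norm (y - z)) powr e * (a + norm (y - z)) powr (-(n + e)) \<le> ?g y"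
      by (intro mult_right_mono) auto
    then show ?thesis using True by (simp flip: powr_add)
  qed simp
  have g: "integrable lebesgue ?g"
    using shifted_norm_powr_lebesgue(1)[of a "n + e" z] a e
    by (intro integrable_mult_right) (simp add: n_def)
  have [measurable]: "cball z 1 \<in> sets lebesgue" by simp
  show f: "integrable lebesgue ?f"
    by (rule Bochner_Integration.integrable_bound[OF g]) (use le in \<open>auto intro!: AE_I2\<close>)
  \<comment> \<open>This is the inequality that makes \<open>e * (ln (a + 1) - ln a)\<close> at most
    1. For large \<open>a\<close> the difference of logarithms is at most 1 / a; for small
    \<open>a\<close> the term \<open>- ln a\<close> is itself
    \<open>\<bar>ln a\<bar>\<close>.\<close>
  have ln_le: "ln (a + 1) - ln a \<le> \<bar>ln a\<bar> + 1"
  proof (cases "a \<ge> 1")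
    case True
    have "ln (a + 1) - ln a = ln ((a + 1) / a)"
      using a by (simp add: ln_div)
    also have "\<dots> = ln (1 + 1 / a)"
      using a by (simp add: add_divide_distrib add.commute)
    also have "\<dots> \<le> 1 / a"
      using a by (intro ln_add_one_self_le_self) simp
    also have "\<dots> \<le> 1"
      using True by simp
    finally show ?thesis by simp
  next
    case False
    then show ?thesis using a ln_add_one_self_le_self[of a] by (simp add: add.commute)
  qed
  have "(a + 1) powr e * a powr (-e) = exp (e * (ln (a + 1) - ln a))"
    using a by (simp add: powr_def algebra_simps flip: exp_add)
  also have "\<dots> \<le> exp 1"
    using ln_le by (simp add: e_def)
  finally have exp_le: "(a + 1) powr e * a powr (-e) \<le> exp 1" .
  have "(\<integral>y. ?f y \<partial>lebesgue) \<le> (\<integral>y. ?g y \<partial>lebesgue)"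
    by (intro integral_mono f g le)
  also have "\<dots> \<le> (a + 1) powr e * ((n + e) * unit_ball_vol n / (n + e - n) * a powr (n - (n + e)))"
    using shifted_norm_powr_lebesgue(2)[of a "n + e" z] a e
    by (subst integral_mult_right_zero, intro mult_left_mono) (auto simp: n_def)
  also have "\<dots> = ((a + 1) powr e * a powr (-e)) * ((n + e) * unit_ball_vol n) * (1 / e)"
    by simp
  also have "\<dots> \<le> exp 1 * ((n + 1) * unit_ball_vol n) * (1 / e)"
    using exp_le e n by (intro mult_mono) auto
  finally show "(\<integral>y. ?f y \<partial>lebesgue) \<le> exp 1 * (n + 1) * unit_ball_vol n * (\<bar>ln a\<bar> + 1)"
    by (simp add: e_def mult_ac)
qed

section \<open>Pairing functions with the weight\<close>

lemma Lp_norm_nonneg [simp]: "0 \<le> Lp_norm p f"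
  by (simp add: Lp_norm_def)

text \<open>For \<open>q > 1\<close> apply Hoelder's inequality with the conjugate exponent
  \<open>r\<close>: the hypothesis on \<open>t\<close> says precisely that \<open>t * r\<close>
  exceeds the dimension, so the \<open>r\<close>-th power of the weight is integrable. For
  \<open>q = 1\<close>, where no finite conjugate exponent exists, the weight is bounded by its
  value at the centre. The constant is obtained before \<open>f\<close>, \<open>a\<close> and
  \<open>z\<close>, hence is uniform in them.\<close>

lemma Lp_pairing_shifted_norm_powr:
  assumes q: "1 \<le> q" and t: "real DIM('a) * (1 - 1 / q) < t"
  obtains K where "K \<ge> 0"
    "\<And>f a z. f \<in> Lp_space q \<Longrightarrow> a > 0 \<Longrightarrow>
      integrable lebesgue (\<lambda>y::'a::euclidean_space. f y * (a + norm (y - z)) powr (-t)) \<and>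
      (\<integral>y. \<bar>f y * (a + norm (y - z)) powr (-t)\<bar> \<partial>lebesgue)
        \<le> K * a powr (real DIM('a) * (1 - 1 / q) - t) * Lp_norm q f"
proof (cases "q = 1")
  case True
  show ?thesis
  proof (rule that[of 1])
    fix f :: "'a \<Rightarrow> real" and a :: real and z :: 'a
    assume f: "f \<in> Lp_space q" and a: "a > 0"
    have [measurable]: "f \<in> borel_measurable lebesgue" and int: "integrable lebesgue (\<lambda>y. \<bar>f y\<bar>)"
      using f True by (auto simp: Lp_space_def)
    have "(a + norm (y - z)) powr (-t) \<le> a powr (-t)" for y
      using a t True by (intro powr_mono2') auto
    then have le: "\<bar>f y * (a + norm (y - z)) powr (-t)\<bar> \<le> a powr (-t) * \<bar>f y\<bar>" for y
      using mult_left_mono[of "(a + norm (y - z)) powr (-t)" "a powr (-t)" "\<bar>f y\<bar>" for y]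
      by (simp add: abs_mult mult.commute)
    have "integrable lebesgue (\<lambda>y. a powr (-t) * \<bar>f y\<bar>)"
      using int by simp
    then have g: "integrable lebesgue (\<lambda>y. f y * (a + norm (y - z)) powr (-t))"
      by (rule Bochner_Integration.integrable_bound) (use le in \<open>auto intro!: AE_I2\<close>)
    have "(\<integral>y. \<bar>f y * (a + norm (y - z)) powr (-t)\<bar> \<partial>lebesgue) \<le> (\<integral>y. a powr (-t) * \<bar>f y\<bar> \<partial>lebesgue)"
      using g int le by (intro integral_mono) auto
    also have "\<dots> = a powr (-t) * Lp_norm q f"
      using True by (simp add: Lp_norm_def)
    finally show "integrable lebesgue (\<lambda>y. f y * (a + norm (y - z)) powr (-t)) \<and>
      (\<integral>y. \<bar>f y * (a + norm (y - z)) powr (-t)\<bar> \<partial>lebesgue)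
        \<le> 1 * a powr (real DIM('a) * (1 - 1 / q) - t) * Lp_norm q f"
      using g True by simp
  qed simp
next
  case False
  then have q: "q > 1" using q by simp
  define r where "r = conj_exponent q"
  define n where "n = real DIM('a)"
  have r: "r > 1" "1 / q + 1 / r = 1"
    using q by (auto simp: r_def conj_exponent_def field_simps)
  have r': "1 - 1 / q = 1 / r" using r by simp
  have tr: "t * r > n"
    using t r r' by (simp add: n_def field_simps)
  define B where "B = t * r * unit_ball_vol n / (t * r - n)"
  have n0: "n \<ge> 0" by (simp add: n_def)
  have B: "B \<ge> 0" using tr n0 by (auto simp: B_def n_def)
  show ?thesis
  proof (rule that[of "B powr (1 / r)"])
    fix f :: "'a \<Rightarrow> real" and a :: real and z :: 'a
    assume f: "f \<in> Lp_space q" and a: "a > 0"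
    define g where "g y = (a + norm (y - z)) powr (-t)" for y
    have g_meas: "g \<in> borel_measurable lebesgue"
      unfolding g_def[abs_def] by measurable
    have gr: "\<bar>g y\<bar> powr r = (a + norm (y - z)) powr (-(t * r))" for y
      by (simp add: g_def powr_powr)
    have g: "g \<in> Lp_space r"
      using shifted_norm_powr_lebesgue(1)[of a "t * r" z] a tr
      by (simp add: Lp_space_def gr g_meas n_def)
    have "Lp_norm r g = (\<integral>y. (a + norm (y - z)) powr (-(t * r)) \<partial>lebesgue) powr (1 / r)"
      by (simp add: Lp_norm_def gr)
    also have "\<dots> \<le> (B * a powr (n - t * r)) powr (1 / r)"
      using shifted_norm_powr_lebesgue(2)[of a "t * r" z] a tr r
      by (intro powr_mono2) (auto simp: n_def B_def)
    also have "\<dots> = B powr (1 / r) * a powr (n * (1 / r) - t)"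
      using a B r by (simp add: powr_mult powr_powr diff_divide_distrib)
    finally have le: "Lp_norm r g \<le> B powr (1 / r) * a powr (n * (1 / r) - t)" .
    have "(\<integral>y. \<bar>f y * g y\<bar> \<partial>lebesgue) \<le> Lp_norm q f * Lp_norm r g"
      by (rule Lp_Holder(2)[OF f g q r])
    also have "\<dots> \<le> Lp_norm q f * (B powr (1 / r) * a powr (n * (1 / r) - t))"
      by (rule mult_left_mono[OF le]) simp
    finally show "integrable lebesgue (\<lambda>y. f y * (a + norm (y - z)) powr (-t)) \<and>
      (\<integral>y. \<bar>f y * (a + norm (y - z)) powr (-t)\<bar> \<partial>lebesgue)
        \<le> B powr (1 / r) * a powr (real DIM('a) * (1 - 1 / q) - t) * Lp_norm q f"
      using Lp_Holder(1)[OF f g q r] by (simp add: r' g_def n_def mult_ac)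
  qed simp
qed

text \<open>Here \<open>t * r\<close> equals the dimension, and the \<open>r\<close>-th power of the
  weight is no longer integrable at infinity. The cutoff to the unit ball restores integrability,
  and the logarithm appears with the power 1 / r = 1 - 1 / p.\<close>

lemma Lp_pairing_shifted_norm_powr_critical:
  assumes p: "1 < p" and t: "real DIM('a) * (1 - 1 / p) = t"
  obtains K where "K \<ge> 0"
    "\<And>f a z. f \<in> Lp_space p \<Longrightarrow> a > 0 \<Longrightarrow>
      integrable lebesgue (\<lambda>y::'a::euclidean_space. f y * (indicator (cball z 1) y * (a + norm (y - z)) powr (-t))) \<and>
      (\<integral>y. \<bar>f y * (indicator (cball z 1) y * (a + norm (y - z)) powr (-t))\<bar> \<partial>lebesgue)
        \<le> K * (\<bar>ln a\<bar> + 1) powr (1 - 1 / p) * Lp_norm p f"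
proof -
  define r where "r = conj_exponent p"
  define n where "n = real DIM('a)"
  have r: "r > 1" "1 / p + 1 / r = 1"
    using p by (auto simp: r_def conj_exponent_def field_simps)
  have r': "1 - 1 / p = 1 / r" using r by simp
  have tr: "t * r = n"
    using t r r' by (auto simp: n_def)
  define B where "B = exp 1 * (n + 1) * unit_ball_vol n"
  have n0: "n \<ge> 0" by (simp add: n_def)
  have B: "B \<ge> 0" using n0 by (auto simp: B_def)
  show ?thesis
  proof (rule that[of "B powr (1 / r)"])
    fix f :: "'a \<Rightarrow> real" and a :: real and z :: 'a
    assume f: "f \<in> Lp_space p" and a: "a > 0"
    define g where "g y = indicator (cball z 1) y * (a + norm (y - z)) powr (-t)" for y
    have gr: "\<bar>g y\<bar> powr r = indicator (cball z 1) y * (a + norm (y - z)) powr (-n)" for y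
      using tr r by (simp add: g_def powr_powr indicator_def)
    have [measurable]: "cball z 1 \<in> sets lebesgue" by simp
    have g_meas: "g \<in> borel_measurable lebesgue"
      unfolding g_def[abs_def] by measurable
    have g: "g \<in> Lp_space r"
      using shifted_norm_powr_critical(1)[of a z] a
      by (simp add: Lp_space_def gr g_meas flip: n_def)
    have "Lp_norm r g = (\<integral>y. indicator (cball z 1) y * (a + norm (y - z)) powr (-n) \<partial>lebesgue) powr (1 / r)"
      by (simp add: Lp_norm_def gr)
    also have "\<dots> \<le> (B * (\<bar>ln a\<bar> + 1)) powr (1 / r)"
      using shifted_norm_powr_critical(2)[of a z] a r
      by (intro powr_mono2) (auto simp: n_def B_def)
    also have "\<dots> = B powr (1 / r) * (\<bar>ln a\<bar> + 1) powr (1 / r)"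
      using B by (simp add: powr_mult)
    finally have le: "Lp_norm r g \<le> B powr (1 / r) * (\<bar>ln a\<bar> + 1) powr (1 / r)" .
    have "(\<integral>y. \<bar>f y * g y\<bar> \<partial>lebesgue) \<le> Lp_norm p f * Lp_norm r g"
      by (rule Lp_Holder(2)[OF f g p r])
    also have "\<dots> \<le> Lp_norm p f * (B powr (1 / r) * (\<bar>ln a\<bar> + 1) powr (1 / r))"
      by (rule mult_left_mono[OF le]) simp
    finally show "integrable lebesgue (\<lambda>y. f y * (indicator (cball z 1) y * (a + norm (y - z)) powr (-t))) \<and>
      (\<integral>y. \<bar>f y * (indicator (cball z 1) y * (a + norm (y - z)) powr (-t))\<bar> \<partial>lebesgue)
        \<le> B powr (1 / r) * (\<bar>ln a\<bar> + 1) powr (1 - 1 / p) * Lp_norm p f"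
      using Lp_Holder(1)[OF f g p r] by (simp add: r' g_def mult_ac)
  qed simp
qed

section \<open>Differences of the integrand and of the operator\<close>

text \<open>The correction term of the kernel does not depend on the point, so it cancels in the
  difference. What remains are the values of the kernel at \<open>y - x\<close> and
  \<open>y - z\<close>, to which the pointwise estimate applies.\<close>

lemma T_integrand_diff:
  fixes x z :: "real ^ 'n::finite"
  assumes "0 \<le> \<beta>" "\<beta> < 1"
  shows "\<bar>T_integrand \<beta> j f x y - T_integrand \<beta> j f z y\<bar>
    \<le> 6 * norm (x - z) * \<bar>f y * (norm (x - z) + norm (y - z)) powr (\<beta> - 1)\<bar>"
proof -
  have "T_integrand \<beta> j f x y - T_integrand \<beta> j f z y =
      ((y - x) $ j / norm (y - x) powr (1 - \<beta>) - (y - z) $ j / norm (y - z) powr (1 - \<beta>)) * f y"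
    by (simp add: T_integrand_def algebra_simps)
  also have "\<bar>\<dots>\<bar> = \<bar>(y - x) $ j / norm (y - x) powr (1 - \<beta>) - (y - z) $ j / norm (y - z) powr (1 - \<beta>)\<bar> * \<bar>f y\<bar>"
    by (rule abs_mult)
  also have "\<dots> \<le> 6 * norm (x - z) * (norm (x - z) + norm (y - z)) powr (\<beta> - 1) * \<bar>f y\<bar>"
    using component_over_norm_powr_diff[OF assms, of "y - x" j "y - z"]
    by (intro mult_right_mono) (auto simp: norm_minus_commute)
  finally show ?thesis by (simp add: abs_mult mult_ac)
qed

lemma T_integrand_measurable [measurable]:
  fixes x :: "real ^ 'n::finite"
  assumes [measurable]: "f \<in> borel_measurable lebesgue"
  shows "T_integrand \<beta> j f x \<in> borel_measurable lebesgue"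
proof -
  have [measurable]: "(\<lambda>y. (y $ j - x $ j) / norm (y - x) powr (1 - \<beta>) - y $ j / norm y powr (1 - \<beta>))
      \<in> borel_measurable lebesgue"
    by (rule measurable_completion) simp
  show ?thesis unfolding T_integrand_def[abs_def] by measurable
qed

text \<open>The integrand vanishes identically at the point 0, so the difference estimate with
  \<open>z = 0\<close> bounds the integrand itself.\<close>

lemma T_integrand_integrable:
  fixes x :: "real ^ 'n::finite"
  assumes \<beta>: "0 \<le> \<beta>" "\<beta> < 1" and [measurable]: "f \<in> borel_measurable lebesgue"
    and int: "\<And>a. a > 0 \<Longrightarrow> integrable lebesgue (\<lambda>y. f y * (a + norm y) powr (\<beta> - 1))"
  shows "integrable lebesgue (T_integrand \<beta> j f x)"
proof (cases "x = 0")
  case False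
  have "integrable lebesgue (\<lambda>y. 6 * norm x * \<bar>f y * (norm x + norm y) powr (\<beta> - 1)\<bar>)"
    using int[of "norm x"] False by simp
  then show ?thesis
    by (rule Bochner_Integration.integrable_bound)
      (use T_integrand_diff[OF \<beta>, of j f x _ 0] in \<open>auto intro!: AE_I2 simp: T_integrand_def[of _ _ _ 0]\<close>)
qed (simp add: T_integrand_def[abs_def])

lemma T_tilde_diff:
  fixes x z :: "real ^ 'n::finite"
  assumes \<beta>: "0 \<le> \<beta>" "\<beta> < 1" and f: "f \<in> borel_measurable lebesgue"
    and int: "\<And>a z. a > 0 \<Longrightarrow> integrable lebesgue (\<lambda>y. f y * (a + norm (y - z)) powr (\<beta> - 1))"
    and "x \<noteq> z"
  shows "\<bar>T_tilde \<beta> j f x - T_tilde \<beta> j f z\<bar>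
    \<le> 6 * \<bar>riesz_const CARD('n) (real CARD('n) - 1 + \<beta>) / (real CARD('n) - 1 + \<beta>)\<bar> * norm (x - z)
      * (\<integral>y. \<bar>f y * (norm (x - z) + norm (y - z)) powr (\<beta> - 1)\<bar> \<partial>lebesgue)"
proof -
  define c where "c = riesz_const CARD('n) (real CARD('n) - 1 + \<beta>) / (real CARD('n) - 1 + \<beta>)"
  \<comment> \<open>Integrability at every point is needed before the two integrals can be merged,
    because a nonintegrable integrand has Bochner integral 0 by convention.\<close>
  have T: "integrable lebesgue (T_integrand \<beta> j f x)" for x
    using T_integrand_integrable[OF \<beta> f] int[of _ 0] by simp
  have "T_tilde \<beta> j f x - T_tilde \<beta> j f z
      = c * (\<integral>y. T_integrand \<beta> j f x y - T_integrand \<beta> j f z y \<partial>lebesgue)"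
    by (simp add: T_tilde_def c_def Bochner_Integration.integral_diff[OF T T] right_diff_distrib)
  also have "\<bar>\<dots>\<bar> = \<bar>c\<bar> * \<bar>\<integral>y. T_integrand \<beta> j f x y - T_integrand \<beta> j f z y \<partial>lebesgue\<bar>"
    by (rule abs_mult)
  also have "\<dots> \<le> \<bar>c\<bar> * (\<integral>y. 6 * norm (x - z) * \<bar>f y * (norm (x - z) + norm (y - z)) powr (\<beta> - 1)\<bar> \<partial>lebesgue)"
  proof (rule mult_left_mono)
    have "\<bar>\<integral>y. T_integrand \<beta> j f x y - T_integrand \<beta> j f z y \<partial>lebesgue\<bar>
      \<le> (\<integral>y. \<bar>T_integrand \<beta> j f x y - T_integrand \<beta> j f z y\<bar> \<partial>lebesgue)"
      by (rule integral_abs_bound)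
    also have "\<dots> \<le> (\<integral>y. 6 * norm (x - z) * \<bar>f y * (norm (x - z) + norm (y - z)) powr (\<beta> - 1)\<bar> \<partial>lebesgue)"
      using T int[of "norm (x - z)" z] \<open>x \<noteq> z\<close>
      by (intro integral_mono T_integrand_diff[OF \<beta>]) auto
    finally show "\<bar>\<integral>y. T_integrand \<beta> j f x y - T_integrand \<beta> j f z y \<partial>lebesgue\<bar> \<le> \<dots>" .
  qed simp
  also have "\<dots> = 6 * \<bar>c\<bar> * norm (x - z) * (\<integral>y. \<bar>f y * (norm (x - z) + norm (y - z)) powr (\<beta> - 1)\<bar> \<partial>lebesgue)"
    by simp
  finally show ?thesis by (simp add: c_def)
qed

section \<open>The critical pairing over the whole space\<close>

text \<open>Inside the unit ball around \<open>z\<close> the critical pairing with the p-norm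
  produces the logarithm. Outside, the weight is comparable to the one with \<open>a = 1\<close>,
  and \<open>q < p\<close> makes \<open>t\<close> supercritical for the q-norm, so that part is
  bounded independently of \<open>a\<close>.\<close>

lemma Lp_pairing_shifted_norm_powr_log:
  assumes p: "1 < p" and t: "real DIM('a) * (1 - 1 / p) = t" "t \<le> 1" and q: "1 \<le> q" "q < p"
  obtains K where "K \<ge> 0"
    "\<And>f a z. f \<in> Lp_space p \<inter> Lp_space q \<Longrightarrow> a > 0 \<Longrightarrow>
      integrable lebesgue (\<lambda>y::'a::euclidean_space. f y * (a + norm (y - z)) powr (-t)) \<and>
      (\<integral>y. \<bar>f y * (a + norm (y - z)) powr (-t)\<bar> \<partial>lebesgue)
        \<le> K * (\<bar>ln a\<bar> + 1) powr (1 - 1 / p) * (Lp_norm p f + Lp_norm q f)"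
proof -
  have "1 - 1 / q < 1 - 1 / p" using q by (simp add: frac_less2)
  then have tq: "real DIM('a) * (1 - 1 / q) < t" using t by (auto intro!: mult_strict_left_mono)
  have t0: "t \<ge> 0" using p t by auto
  obtain K where K: "K \<ge> 0" "\<And>f a z. f \<in> Lp_space p \<Longrightarrow> a > 0 \<Longrightarrow>
      integrable lebesgue (\<lambda>y::'a. f y * (indicator (cball z 1) y * (a + norm (y - z)) powr (-t))) \<and>
      (\<integral>y. \<bar>f y * (indicator (cball z 1) y * (a + norm (y - z)) powr (-t))\<bar> \<partial>lebesgue)
        \<le> K * (\<bar>ln a\<bar> + 1) powr (1 - 1 / p) * Lp_norm p f"
    using that by (rule Lp_pairing_shifted_norm_powr_critical[OF p t(1)])
  obtain L where L: "L \<ge> 0" "\<And>f a z. f \<in> Lp_space q \<Longrightarrow> a > 0 \<Longrightarrow>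
      integrable lebesgue (\<lambda>y::'a. f y * (a + norm (y - z)) powr (-t)) \<and>
      (\<integral>y. \<bar>f y * (a + norm (y - z)) powr (-t)\<bar> \<partial>lebesgue)
        \<le> L * a powr (real DIM('a) * (1 - 1 / q) - t) * Lp_norm q f"
    using that by (rule Lp_pairing_shifted_norm_powr[OF q(1) tq])
  show ?thesis
  proof (rule that[of "K + 2 * L"])
    fix f :: "'a \<Rightarrow> real" and a :: real and z :: 'a
    assume f: "f \<in> Lp_space p \<inter> Lp_space q" and a: "a > 0"
    define g where "g y = f y * (a + norm (y - z)) powr (-t)" for y
    define g1 where "g1 y = f y * (indicator (cball z 1) y * (a + norm (y - z)) powr (-t))" for y
    define g2 where "g2 y = f y * (1 + norm (y - z)) powr (-t)" for y
    define M where "M = (\<bar>ln a\<bar> + 1) powr (1 - 1 / p)"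
    \<comment> \<open>This lower bound lets the logarithmic factor absorb the exterior term, which
      carries no logarithm.\<close>
    have M: "M \<ge> 1" using p by (auto simp: M_def intro!: ge_one_powr_ge_zero)
    have g1: "integrable lebesgue g1" "(\<integral>y. \<bar>g1 y\<bar> \<partial>lebesgue) \<le> K * M * Lp_norm p f"
      using K(2)[of f a z] f a by (auto simp: g1_def[abs_def] M_def)
    have g2: "integrable lebesgue g2" "(\<integral>y. \<bar>g2 y\<bar> \<partial>lebesgue) \<le> L * Lp_norm q f"
      using L(2)[of f 1 z] f by (auto simp: g2_def[abs_def])
    have le: "\<bar>g y\<bar> \<le> \<bar>g1 y\<bar> + 2 * \<bar>g2 y\<bar>" for y
    proof (cases "y \<in> cball z 1")
      case False
      then have r: "norm (y - z) > 1" by (simp add: dist_norm norm_minus_commute)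
      \<comment> \<open>Outside the ball the distance exceeds 1, hence is at least half of
        \<open>1 + norm (y - z)\<close>. Together with \<open>t \<le> 1\<close> this gives the
        factor 2 powr t \<le> 2, the source of the 2 in \<open>K + 2 * L\<close>.\<close>
      have "(a + norm (y - z)) powr (-t) \<le> ((1 + norm (y - z)) / 2) powr (-t)"
        using a r t0 by (intro powr_mono2') auto
      also have "\<dots> = 2 powr t * (1 + norm (y - z)) powr (-t)"
        by (simp add: powr_divide powr_minus_divide)
      also have "\<dots> \<le> 2 * (1 + norm (y - z)) powr (-t)"
        using t powr_mono[of t 1 "2::real"] by (intro mult_right_mono) auto
      finally have "\<bar>f y\<bar> * (a + norm (y - z)) powr (-t) \<le> \<bar>f y\<bar> * (2 * (1 + norm (y - z)) powr (-t))"
        by (rule mult_left_mono) simp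
      then show ?thesis using False by (simp add: g_def g1_def g2_def abs_mult)
    qed (simp add: g_def g1_def)
    have [measurable]: "f \<in> borel_measurable lebesgue"
      using f by (simp add: Lp_space_def)
    have "integrable lebesgue (\<lambda>y. \<bar>g1 y\<bar> + 2 * \<bar>g2 y\<bar>)"
      using g1 g2 by simp
    then have g: "integrable lebesgue g"
      by (rule Bochner_Integration.integrable_bound) (use le in \<open>auto simp: g_def[abs_def]\<close>)
    have "(\<integral>y. \<bar>g y\<bar> \<partial>lebesgue) \<le> (\<integral>y. \<bar>g1 y\<bar> + 2 * \<bar>g2 y\<bar> \<partial>lebesgue)"
      using g g1 g2 le by (intro integral_mono) auto
    also have "\<dots> \<le> K * M * Lp_norm p f + 2 * (L * Lp_norm q f)"
      using g1 g2 by simp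
    also have "\<dots> \<le> (K + 2 * L) * M * Lp_norm p f + (K + 2 * L) * M * Lp_norm q f"
    proof (rule add_mono)
      show "K * M * Lp_norm p f \<le> (K + 2 * L) * M * Lp_norm p f"
        using M L(1) by (intro mult_right_mono) auto
      have "2 * L * 1 \<le> (K + 2 * L) * M"
        using M K(1) L(1) by (intro mult_mono) auto
      then show "2 * (L * Lp_norm q f) \<le> (K + 2 * L) * M * Lp_norm q f"
        using mult_right_mono[of "2 * L" "(K + 2 * L) * M" "Lp_norm q f"] by simp
    qed
    also have "\<dots> = (K + 2 * L) * M * (Lp_norm p f + Lp_norm q f)"
      by (simp add: distrib_left)
    finally show "integrable lebesgue (\<lambda>y. f y * (a + norm (y - z)) powr (-t)) \<and>
      (\<integral>y. \<bar>f y * (a + norm (y - z)) powr (-t)\<bar> \<partial>lebesgue)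
        \<le> (K + 2 * L) * (\<bar>ln a\<bar> + 1) powr (1 - 1 / p) * (Lp_norm p f + Lp_norm q f)"
      using g by (simp add: g_def[abs_def] M_def)
  qed (use K L in auto)
qed

section \<open>From weight estimates to moduli of continuity\<close>

text \<open>The common final step of both parts: \<open>S\<close> is the function class,
  \<open>\<mu>\<close> its norm expression, and \<open>\<omega>\<close> the growth of the pairing in
  \<open>a\<close>. The factor \<open>norm (x - z)\<close> comes from the kernel estimate.\<close>

lemma T_tilde_modulus_of_continuity:
  fixes S :: "(real ^ 'n::finite \<Rightarrow> real) set"
  assumes \<beta>: "0 \<le> \<beta>" "\<beta> < 1" and S: "S \<subseteq> borel_measurable lebesgue"
    and K: "\<And>f a z. f \<in> S \<Longrightarrow> a > 0 \<Longrightarrow>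
      integrable lebesgue (\<lambda>y. f y * (a + norm (y - z)) powr (-(1 - \<beta>))) \<and>
      (\<integral>y. \<bar>f y * (a + norm (y - z)) powr (-(1 - \<beta>))\<bar> \<partial>lebesgue) \<le> K * \<omega> a * \<mu> f"
  shows "(\<forall>f \<in> S. \<forall>(j::'n) x. integrable lebesgue (T_integrand \<beta> j f x)) \<and>
    (\<exists>C::real. \<forall>f \<in> S. \<forall>(j::'n) (x::real^'n) (z::real^'n).
      \<bar>T_tilde \<beta> j f x - T_tilde \<beta> j f z\<bar> \<le> C * (norm (x - z) * \<omega> (norm (x - z))) * \<mu> f)"
proof (intro conjI exI ballI allI)
  fix f and j :: 'n and x :: "real ^ 'n"
  assume f: "f \<in> S"
  show "integrable lebesgue (T_integrand \<beta> j f x)"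
    using K[OF f, of _ 0] S f by (intro T_integrand_integrable[OF \<beta>]) auto
next
  fix f and j :: 'n and x z :: "real ^ 'n"
  assume f: "f \<in> S"
  define D where
    "D = 6 * \<bar>riesz_const CARD('n) (real CARD('n) - 1 + \<beta>) / (real CARD('n) - 1 + \<beta>)\<bar>"
  \<comment> \<open>This goal fixes the witness \<open>C\<close> left open by \<open>exI\<close>: 6
    from the kernel estimate, the normalising constant of the operator, and \<open>K\<close>. None
    of them depends on \<open>f\<close>, \<open>j\<close>, \<open>x\<close> or
    \<open>z\<close>.\<close>
  show "\<bar>T_tilde \<beta> j f x - T_tilde \<beta> j f z\<bar>
    \<le> (6 * \<bar>riesz_const CARD('n) (real CARD('n) - 1 + \<beta>) / (real CARD('n) - 1 + \<beta>)\<bar> * K)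
      * (norm (x - z) * \<omega> (norm (x - z))) * \<mu> f"
  \<comment> \<open>For \<open>x = z\<close> the factor \<open>norm (x - z)\<close> makes the
    right-hand side 0, whatever value \<open>\<omega> 0\<close> has; in particular the conventional
    value of \<open>ln 0\<close> does no harm.\<close>
  proof (cases "x = z")
    case False
    have "\<bar>T_tilde \<beta> j f x - T_tilde \<beta> j f z\<bar>
        \<le> D * norm (x - z) * (\<integral>y. \<bar>f y * (norm (x - z) + norm (y - z)) powr (\<beta> - 1)\<bar> \<partial>lebesgue)"
      unfolding D_def using K[OF f] S f False by (intro T_tilde_diff[OF \<beta>]) auto
    also have "\<dots> \<le> D * norm (x - z) * (K * \<omega> (norm (x - z)) * \<mu> f)"
      using K[OF f, of "norm (x - z)" z] False by (intro mult_left_mono) (auto simp: D_def)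
    finally show ?thesis by (simp add: D_def mult_ac)
  qed simp
qed

theorem theoremD:
  fixes \<beta> :: real
  assumes "0 \<le> \<beta>" and "\<beta> < 1"
    and "(CARD('n::finite), \<beta>) \<noteq> (1, 0)"
  shows
    "(\<forall>p::real. 1 < p \<and> p < real CARD('n) / (real CARD('n) - 1 + \<beta>) \<longrightarrow>
        (\<forall>f \<in> Lp_space p. \<forall>(j::'n) x. integrable lebesgue (T_integrand \<beta> j f x)) \<and>
        (\<exists>C::real. \<forall>f \<in> Lp_space p. \<forall>(j::'n) (x::real^'n) (z::real^'n).
           \<bar>T_tilde \<beta> j f x - T_tilde \<beta> j f z\<bar>
             \<le> C * norm (x - z) powr (real CARD('n) + \<beta> - real CARD('n) / p) * Lp_norm p f))
     \<and>
     (\<forall>p q::real. p = real CARD('n) / (real CARD('n) - 1 + \<beta>) \<and> 1 \<le> q \<and> q < p \<longrightarrow>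
        (\<forall>f \<in> Lp_space p \<inter> Lp_space q. \<forall>(j::'n) x. integrable lebesgue (T_integrand \<beta> j f x)) \<and>
        (\<exists>C::real. \<forall>f \<in> Lp_space p \<inter> Lp_space q. \<forall>(j::'n) (x::real^'n) (z::real^'n).
           \<bar>T_tilde \<beta> j f x - T_tilde \<beta> j f z\<bar>
             \<le> C * (norm (x - z) * (\<bar>ln (norm (x - z))\<bar> + 1) powr (1 / conj_exponent p))
                 * (Lp_norm p f + Lp_norm q f)))"
proof -
  define n where "n = real CARD('n)"
  define D where "D = n - 1 + \<beta>"
  have "CARD('n) \<noteq> 0"
    by simp
  then have "CARD('n) = 1 \<or> CARD('n) \<ge> 2"
    by linarith
  \<comment> \<open>In dimension 1 the excluded pair forces \<beta> > 0, so \<open>D\<close> is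
    positive in every case.\<close>
  then have n: "n \<ge> 1" and D: "D > 0"
    using assms by (auto simp: D_def n_def order_le_less)
  have meas: "Lp_space p \<subseteq> borel_measurable lebesgue" for p
    by (auto simp: Lp_space_def)
  have subcritical: "(\<forall>f \<in> Lp_space p. \<forall>(j::'n) x. integrable lebesgue (T_integrand \<beta> j f x)) \<and>
        (\<exists>C::real. \<forall>f \<in> Lp_space p. \<forall>(j::'n) (x::real^'n) (z::real^'n).
           \<bar>T_tilde \<beta> j f x - T_tilde \<beta> j f z\<bar>
             \<le> C * norm (x - z) powr (n + \<beta> - n / p) * Lp_norm p f)"
    if p: "1 < p" "p < n / D" for p
  proof -
    \<comment> \<open>The condition p < n / D, rearranged, is exactly the supercriticality required
      of the weight exponent 1 - \<beta>.\<close>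
    have "n * (1 - 1 / p) < 1 - \<beta>"
      using p D by (simp add: D_def field_simps)
    then have t: "real DIM(real^'n) * (1 - 1 / p) < 1 - \<beta>"
      by (simp add: n_def)
    \<comment> \<open>The factor \<open>h\<close> from the kernel estimate raises the exponent by 1
      to the claimed one. At \<open>h = 0\<close> both sides are 0, since \<open>0 powr\<close> of
      anything is 0.\<close>
    have h: "h * h powr (n * (1 - 1 / p) - (1 - \<beta>)) = h powr (n + \<beta> - n / p)" if "h \<ge> 0" for h :: real
      using that by (simp add: powr_mult_base algebra_simps)
    obtain K where "K \<ge> 0" and K: "\<And>f a z. f \<in> Lp_space p \<Longrightarrow> a > 0 \<Longrightarrow>
      integrable lebesgue (\<lambda>y::real^'n. f y * (a + norm (y - z)) powr (-(1 - \<beta>))) \<and>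
      (\<integral>y. \<bar>f y * (a + norm (y - z)) powr (-(1 - \<beta>))\<bar> \<partial>lebesgue)
        \<le> K * a powr (real DIM(real^'n) * (1 - 1 / p) - (1 - \<beta>)) * Lp_norm p f"
      using that by (rule Lp_pairing_shifted_norm_powr[OF less_imp_le[OF p(1)] t])
    from T_tilde_modulus_of_continuity[OF assms(1,2) meas K]
    show ?thesis by (simp add: h flip: n_def)
  qed
  have critical: "(\<forall>f \<in> Lp_space p \<inter> Lp_space q. \<forall>(j::'n) x. integrable lebesgue (T_integrand \<beta> j f x)) \<and>
        (\<exists>C::real. \<forall>f \<in> Lp_space p \<inter> Lp_space q. \<forall>(j::'n) (x::real^'n) (z::real^'n).
           \<bar>T_tilde \<beta> j f x - T_tilde \<beta> j f z\<bar>
             \<le> C * (norm (x - z) * (\<bar>ln (norm (x - z))\<bar> + 1) powr (1 / conj_exponent p))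
                 * (Lp_norm p f + Lp_norm q f))"
    if p: "p = n / D" and q: "1 \<le> q" "q < p" for p q
  proof -
    \<comment> \<open>At the endpoint the strict inequality of the first part becomes an equality,
      so the weight exponent 1 - \<beta> is critical for \<open>p\<close>.\<close>
    have "n * (1 / p) = D"
      using p D n by simp
    then have "n * (1 - 1 / p) = 1 - \<beta>"
      by (simp add: D_def right_diff_distrib)
    then have t: "real DIM(real^'n) * (1 - 1 / p) = 1 - \<beta>"
      by (simp add: n_def)
    have p1: "1 < p" and \<beta>1: "1 - \<beta> \<le> 1" using q assms by auto
    have conj: "1 / conj_exponent p = 1 - 1 / p"
      using p1 by (simp add: conj_exponent_def field_simps)
    obtain K where "K \<ge> 0" and K: "\<And>f a z. f \<in> Lp_space p \<inter> Lp_space q \<Longrightarrow> a > 0 \<Longrightarrow>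
      integrable lebesgue (\<lambda>y::real^'n. f y * (a + norm (y - z)) powr (-(1 - \<beta>))) \<and>
      (\<integral>y. \<bar>f y * (a + norm (y - z)) powr (-(1 - \<beta>))\<bar> \<partial>lebesgue)
        \<le> K * (\<bar>ln a\<bar> + 1) powr (1 - 1 / p) * (Lp_norm p f + Lp_norm q f)"
      using that by (rule Lp_pairing_shifted_norm_powr_log[OF p1 t \<beta>1 q])
    from T_tilde_modulus_of_continuity[OF assms(1,2) le_infI1[OF meas] K]
    show ?thesis unfolding conj .
  qed
  show ?thesis
    using subcritical critical unfolding n_def D_def by blast
qed

end
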